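(* Let $O\subseteq\mathbb{R}$ be an interval with Borel $\sigma$-algebra $\mathcal{O}$, let $\mathcal{P}$ be a family of probability measures on $(O,\mathcal{O})$, and let $\mathrm{S}:\mathcal{P}\times O\to(-\infty,\infty]$ be a map such that for each $\mathrm{P}\in\mathcal{P}$ the function $\mathrm{S}(\mathrm{P};\cdot)$ is Borel-measurable and for all $\mathrm{P},\mathrm{Q}\in\mathcal{P}$ the integral $\int_O\mathrm{S}(\mathrm{P};y)\,\mathrm{d}\mathrm{Q}(y)$ exists. Suppose that (i) for each $y\in O$, the map $\mathrm{S}(\cdot;y):\mathcal{P}\to(-\infty,\infty]$ is $\mathcal{A}(\mathcal{P})$-$\mathcal{B}$-measurable; (ii) for each $\mathrm{P}\in\mathcal{P}$, the map $y\mapsto\mathrm{S}(\mathrm{P};y)$ is right-continuous (or, alternatively, for each $\mathrm{P}\in\mathcal{P}$ it is left-continuous). Then $\mathrm{S}:\mathcal{P}\times O\to(-\infty,\infty]$ is $\mathcal{A}(\mathcal{P})\otimes\mathcal{O}$-$\mathcal{B}$-measurable.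
   Context: Here $\mathcal{B}$ denotes the Borel $\sigma$-algebra of the range $(-\infty,\infty]$, and continuity of $(-\infty,\infty]$-valued maps is with respect to the usual topology of the extended real line. Let $\mathcal{Q}$ be the family of all probability measures on $(O,\mathcal{O})$. For $B\in\mathcal{O}$ the evaluation map is $\pi_B:\mathcal{Q}\to[0,1]$, $\pi_B(\mathrm{P})=\mathrm{P}(B)$. $\mathcal{A}(\mathcal{Q})$ is the smallest $\sigma$-algebra on $\mathcal{Q}$ making all $\pi_B$, $B\in\mathcal{O}$, measurable with respect to the Borel $\sigma$-algebra of $[0,1]$. For $\mathcal{P}\subseteq\mathcal{Q}$, $\mathcal{A}(\mathcal{P})=\{\mathcal{P}\cap C\mid C\in\mathcal{A}(\mathcal{Q})\}$ is the trace $\sigma$-algebra on $\mathcal{P}$ (equivalently, the $\sigma$-algebra generated by the restrictions of the maps $\pi_B$ to $\mathcal{P}$). $\mathcal{A}(\mathcal{P})\otimes\mathcal{O}$ is the product $\sigma$-algebra. *)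

theory Defs
  imports "HOL-Probability.Probability"
begin

abbreviation borel_of :: "real set \<Rightarrow> real measure" where
  "borel_of I \<equiv> restrict_space borel I"

text \<open>
  The family of all probability measures on \<open>M\<close> with the \<open>\<sigma>\<close>-algebra generated by the
  evaluation maps is \<^const>\<open>prob_algebra\<close>. The library builds it from the
  \<^typ>\<open>ennreal\<close>-valued \<^const>\<open>emeasure\<close> on subprobability measures; the next two lemmas
  identify it with the smallest \<open>\<sigma>\<close>-algebra that makes all maps \<open>P \<mapsto> P(B)\<close> into \<open>[0,1]\<close>
  measurable.
\<close>

lemma space_prob_algebra_eq:
  "space (prob_algebra M) = {P. prob_space P \<and> sets P = sets M}"
  by (auto simp: space_prob_algebra)

lemma sets_prob_algebra_eq:
  "sets (prob_algebra M) = sigma_sets (space (prob_algebra M))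
     {(\<lambda>P. measure P B) -` U \<inter> space (prob_algebra M) | B U.
        B \<in> sets M \<and> U \<in> sets (borel_of {0..1})}" (is "_ = sigma_sets ?Q ?G")
proof
  have G: "?G \<subseteq> Pow ?Q" by auto
  have ev: "(\<lambda>P. measure P B) \<in> prob_algebra M \<rightarrow>\<^sub>M borel_of {0..1}" if "B \<in> sets M" for B
  proof (rule measurable_restrict_space2)
    show "(\<lambda>P. measure P B) \<in> space (prob_algebra M) \<rightarrow> {0..1}"
      by (auto simp: space_prob_algebra prob_space.prob_le_1)
    show "(\<lambda>P. measure P B) \<in> borel_measurable (prob_algebra M)"
      unfolding prob_algebra_def
      by (intro measurable_restrict_space1 measurable_measure_subprob_algebra that)
  qed
  show "sigma_sets ?Q ?G \<subseteq> sets (prob_algebra M)"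
    by (rule sets.sigma_sets_subset) (auto intro: measurable_sets[OF ev])
  have ev': "(\<lambda>P. emeasure P B) \<in> borel_measurable (sigma ?Q ?G)" if B: "B \<in> sets M" for B
  proof -
    have "(\<lambda>P. measure P B) \<in> borel_measurable (sigma ?Q ?G)"
    proof (rule measurableI)
      fix U :: "real set" assume U: "U \<in> sets borel"
      have "(\<lambda>P. measure P B) -` U \<inter> ?Q = (\<lambda>P. measure P B) -` (U \<inter> {0..1}) \<inter> ?Q"
        by (auto simp: space_prob_algebra prob_space.prob_le_1)
      moreover have "U \<inter> {0..1} \<in> sets (borel_of {0..1})"
        using U by (auto simp: sets_restrict_space)
      ultimately have "(\<lambda>P. measure P B) -` U \<inter> ?Q \<in> ?G" using B by blast
      then show "(\<lambda>P. measure P B) -` U \<inter> space (sigma ?Q ?G) \<in> sets (sigma ?Q ?G)"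
        using G by (simp add: sets_measure_of space_measure_of)
    qed simp
    then have "(\<lambda>P. ennreal (measure P B)) \<in> borel_measurable (sigma ?Q ?G)" by measurable
    then show ?thesis
      by (rule measurable_cong[THEN iffD1, rotated])
         (use G in \<open>auto simp: space_measure_of space_prob_algebra prob_space_def
            finite_measure.emeasure_eq_measure\<close>)
  qed
  have "(\<lambda>P. P) \<in> sigma ?Q ?G \<rightarrow>\<^sub>M prob_algebra M"
    using G ev'
    by (intro measurable_prob_algebraI measurable_subprob_algebra)
       (auto simp: space_measure_of space_prob_algebra intro: prob_space_imp_subprob_space)
  from measurable_sets[OF this] show "sets (prob_algebra M) \<subseteq> sigma_sets ?Q ?G"
    using G sets.sets_into_space[of _ "prob_algebra M"]
    by (fastforce simp: space_measure_of sets_measure_of Int_absorb2)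
qed

text \<open>The trace \<open>\<sigma>\<close>-algebra on a family \<open>\<P>\<close> of probability measures on \<open>M\<close>.\<close>

abbreviation eval_algebra :: "'a measure \<Rightarrow> 'a measure set \<Rightarrow> 'a measure measure" where
  "eval_algebra M \<P> \<equiv> restrict_space (prob_algebra M) \<P>"

abbreviation ereal_gt_minf :: "ereal measure" where
  "ereal_gt_minf \<equiv> restrict_space borel {-\<infinity><..}"

text \<open>
  Existence of the integral of an extended real function in the wide sense: the positive or the
  negative part has a finite integral, so the value \<open>\<plusminus>\<infinity>\<close> is permitted.
\<close>

definition integral_exists :: "'a measure \<Rightarrow> ('a \<Rightarrow> ereal) \<Rightarrow> bool" where
  "integral_exists M f \<longleftrightarrow> f \<in> borel_measurable M \<and>
     ((\<integral>\<^sup>+ x. e2ennreal (max 0 (f x)) \<partial>M) < \<infinity> \<or> (\<integral>\<^sup>+ x. e2ennreal (max 0 (- f x)) \<partial>M) < \<infinity>)"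

text \<open>
  One-sided continuity relative to the domain \<open>I\<close>; it holds trivially at an end point of \<open>I\<close> that
  cannot be approached from the relevant side.
\<close>

definition right_continuous_on :: "real set \<Rightarrow> (real \<Rightarrow> 'b::topological_space) \<Rightarrow> bool" where
  "right_continuous_on I f \<longleftrightarrow> (\<forall>y\<in>I. (f \<longlongrightarrow> f y) (at y within (I \<inter> {y<..})))"

definition left_continuous_on :: "real set \<Rightarrow> (real \<Rightarrow> 'b::topological_space) \<Rightarrow> bool" where
  "left_continuous_on I f \<longleftrightarrow> (\<forall>y\<in>I. (f \<longlongrightarrow> f y) (at y within (I \<inter> {..<y})))"

end

theory Submission
  imports Defs
begin

text \<open>
  A one-sided continuous function is a pointwise limit of step functions: if points \<open>d\<^sub>n(y)\<close> of a
  countable subset of \<open>I\<close> converge to \<open>y\<close> from the side on which the functions are continuous,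
  then \<open>S(P; d\<^sub>n(y))\<close> converges to \<open>S(P; y)\<close>, whatever \<open>P\<close> is. The map \<open>(P, y) \<mapsto> S(P; d\<^sub>n(y))\<close> is
  jointly measurable, because on each of the countably many strips \<open>d\<^sub>n(y) = c\<close> it is
  \<open>S(P; c)\<close>, which depends measurably on \<open>P\<close>. Hence the limit \<open>S\<close> is jointly measurable; this is
  \<open>borel_measurable_split_step_limit\<close>.

  What remains is to find \<open>d\<^sub>n\<close> (\<open>directed_step_approximation\<close>). The next point of the grid
  of width \<open>1/(n+1)\<close> lies strictly beyond \<open>y\<close> and converges to \<open>y\<close>, and as \<open>I\<close> is an interval, it
  eventually belongs to \<open>I\<close>, unless \<open>y\<close> is the end point of \<open>I\<close> in that direction. A single
  exceptional value, the end point itself, repairs this case.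
\<close>

text \<open>
  Replacing \<open>y\<close> by a countably valued \<open>d n y\<close> reduces joint measurability to that of the
  sections with \<open>y\<close> fixed. The limit is taken in the order topology,
  because the topology of \<^typ>\<open>ereal\<close> is given by its order and not by a metric.
\<close>

lemma borel_measurable_split_step_limit:
  fixes f :: "'a \<Rightarrow> 'b \<Rightarrow> 'c::{complete_linorder, second_countable_topology, linorder_topology}"
  assumes C: "countable C"
    and d: "\<And>n. d n \<in> N \<rightarrow>\<^sub>M count_space C"
    and f: "\<And>c. c \<in> C \<Longrightarrow> (\<lambda>x. f x c) \<in> borel_measurable M"
    and lim: "\<And>x y. x \<in> space M \<Longrightarrow> y \<in> space N \<Longrightarrow> (\<lambda>n::nat. f x (d n y)) \<longlonglongrightarrow> f x y"
  shows "(\<lambda>(x, y). f x y) \<in> borel_measurable (M \<Otimes>\<^sub>M N)"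
proof (rule borel_measurable_LIMSEQ_order)
  fix n
  have "(\<lambda>z. f (fst z) (d n (snd z))) \<in> borel_measurable (M \<Otimes>\<^sub>M N)"
  proof (rule measurable_compose_countable'[where I = C and f = "\<lambda>c z. f (fst z) c"])
    show "(\<lambda>z. f (fst z) c) \<in> borel_measurable (M \<Otimes>\<^sub>M N)" if "c \<in> C" for c
      using measurable_compose[OF measurable_fst f[OF that]] .
    show "(\<lambda>z. d n (snd z)) \<in> M \<Otimes>\<^sub>M N \<rightarrow>\<^sub>M count_space C"
      by (rule measurable_compose[OF measurable_snd d])
  qed (rule C)
  then show "(\<lambda>(x, y). f x (d n y)) \<in> borel_measurable (M \<Otimes>\<^sub>M N)"
    by (simp add: case_prod_beta)
qed (auto simp: space_pair_measure intro: lim)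

text \<open>
  The sign \<open>s\<close> selects the direction: \<open>1\<close> approximates from above and \<open>-1\<close> from below. If \<open>I\<close>
  contains its end point in this direction, no point of \<open>I\<close> lies beyond it, so there the
  approximation has to be exact.
\<close>

lemma directed_step_approximation:
  fixes I :: "real set" and s :: real
  assumes I: "is_interval I" "I \<noteq> {}" and s: "s \<in> {1, -1}"
  obtains C :: "real set" and d :: "nat \<Rightarrow> real \<Rightarrow> real" where
    "countable C" "C \<subseteq> I" "\<And>n. d n \<in> borel_of I \<rightarrow>\<^sub>M count_space C"
    "\<And>y. y \<in> I \<Longrightarrow> (\<forall>\<^sub>F n in sequentially. d n y = y) \<or>
      ((\<lambda>n. d n y) \<longlonglongrightarrow> y \<and> (\<forall>\<^sub>F n in sequentially. s * y < s * d n y))"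
proof -
  have ss: "s * (s * x) = x" for x using s by auto
  define g where "g n y = s * (of_int \<lfloor>s * y * real (Suc n)\<rfloor> + 1) / real (Suc n)" for n y
  have sg: "s * g n y = (of_int \<lfloor>s * y * real (Suc n)\<rfloor> + 1) / real (Suc n)" for n y
    using ss by (simp add: g_def)
  have g_gt: "s * y < s * g n y" for n y
    unfolding sg by (simp add: less_divide_eq del: of_nat_Suc)
  have g_le: "s * g n y \<le> s * y + 1 / real (Suc n)" for n y
  proof -
    have "(of_int \<lfloor>s * y * real (Suc n)\<rfloor> + 1) / real (Suc n) \<le> (s * y * real (Suc n) + 1) / real (Suc n)"
      by (rule divide_right_mono) auto
    then show ?thesis unfolding sg by (simp add: add_divide_distrib del: of_nat_Suc)
  qed
  have sg_lim: "(\<lambda>n. s * g n y) \<longlonglongrightarrow> s * y" for y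
  proof (rule tendsto_sandwich[OF _ _ tendsto_const])
    show "(\<lambda>n. s * y + 1 / real (Suc n)) \<longlonglongrightarrow> s * y"
      using tendsto_add[OF tendsto_const LIMSEQ_inverse_real_of_nat, of "s * y"]
      by (simp add: inverse_eq_divide)
  qed (use g_gt g_le in \<open>auto intro!: always_eventually less_imp_le\<close>)
  have g_lim: "(\<lambda>n. g n y) \<longlonglongrightarrow> y" for y
    using tendsto_mult[OF tendsto_const sg_lim, of s y] by (simp add: ss)

  \<comment> \<open>If \<open>I\<close> has no end point in this direction, any element serves, because each \<open>y\<close> falls back on
    it for finitely many \<open>n\<close> only.\<close>
  obtain e where e: "e \<in> I" and e_end: "\<And>y. y \<in> I \<Longrightarrow> \<forall>z\<in>I. s * z \<le> s * y \<Longrightarrow> e = y"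
  proof (cases "\<exists>y\<in>I. \<forall>z\<in>I. s * z \<le> s * y")
    case True
    then obtain y where "y \<in> I" "\<forall>z\<in>I. s * z \<le> s * y" by blast
    then show ?thesis by (intro that[of y]) (metis antisym ss)+
  next
    case False
    then show ?thesis using I(2) that by blast
  qed
  define d where "d n y = (if g n y \<in> I then g n y else e)" for n y
  define C where "C = insert e (I \<inter> (\<Union>n. range (\<lambda>k::int. s * (of_int k + 1) / real (Suc n))))"
  show ?thesis
  proof (rule that[of C d])
    show C: "countable C" unfolding C_def by (intro countable_insert countable_Int2 countable_UN) auto
    show "C \<subseteq> I" using e by (auto simp: C_def)
    show "d n \<in> borel_of I \<rightarrow>\<^sub>M count_space C" for n
    proof (subst measurable_count_space_eq_countable[OF C], intro conjI ballI)
      show "d n \<in> space (borel_of I) \<rightarrow> C"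
      proof
        fix y
        have "g n y \<in> (\<Union>n. range (\<lambda>k::int. s * (of_int k + 1) / real (Suc n)))"
          unfolding g_def by blast
        then show "d n y \<in> C" by (simp add: d_def C_def)
      qed
      have I': "I \<in> sets borel" by (rule real_interval_borel_measurable[OF I(1)])
      have g: "g n \<in> borel_measurable borel" unfolding g_def by measurable
      have "d n \<in> borel_measurable borel"
        unfolding d_def using g I' by measurable
      then have "d n \<in> borel_measurable (borel_of I)" by (rule measurable_restrict_space1)
      then show "d n -` {c} \<inter> space (borel_of I) \<in> sets (borel_of I)" for c
        by (rule measurable_sets) simp
    qed
    fix y assume y: "y \<in> I"
    show "(\<forall>\<^sub>F n in sequentially. d n y = y) \<or>
      ((\<lambda>n. d n y) \<longlonglongrightarrow> y \<and> (\<forall>\<^sub>F n in sequentially. s * y < s * d n y))"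
    proof (cases "\<forall>z\<in>I. s * z \<le> s * y")
      case True
      then have "d n y = y" for n
        using g_gt[of y n] e_end[OF y True] by (auto simp: d_def not_le[symmetric])
      then show ?thesis by simp
    next
      case False
      then obtain z where z: "z \<in> I" "s * y < s * z" by force
      have "\<forall>\<^sub>F n in sequentially. s * g n y < s * z"
        using order_tendstoD(2)[OF sg_lim z(2)] .
      then have eq: "\<forall>\<^sub>F n in sequentially. d n y = g n y"
      proof eventually_elim
        case (elim n)
        have "g n y \<in> I"
          using s elim g_gt[of y n] mem_is_interval_1_I[OF I(1) y z(1), of "g n y"]
            mem_is_interval_1_I[OF I(1) z(1) y, of "g n y"] by auto
        then show ?case by (simp add: d_def)
      qed
      then have "\<forall>\<^sub>F n in sequentially. s * y < s * d n y"
        by eventually_elim (simp add: g_gt)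
      moreover have "(\<lambda>n. d n y) \<longlonglongrightarrow> y"
        using g_lim tendsto_cong[OF eq] by blast
      ultimately show ?thesis by blast
    qed
  qed
qed

theorem lemma5p1:
  fixes I :: "real set" and \<P> :: "real measure set" and S :: "real measure \<Rightarrow> real \<Rightarrow> ereal"
  assumes interval: "is_interval I"
    and family: "\<P> \<subseteq> space (prob_algebra (borel_of I))"
    and range: "\<And>P y. P \<in> \<P> \<Longrightarrow> y \<in> I \<Longrightarrow> S P y \<in> {-\<infinity><..}"
    and borel: "\<And>P. P \<in> \<P> \<Longrightarrow> (\<lambda>y. S P y) \<in> borel_of I \<rightarrow>\<^sub>M ereal_gt_minf"
    and integral: "\<And>P Q. P \<in> \<P> \<Longrightarrow> Q \<in> \<P> \<Longrightarrow> integral_exists Q (\<lambda>y. S P y)"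
    and meas: "\<And>y. y \<in> I \<Longrightarrow> (\<lambda>P. S P y) \<in> eval_algebra (borel_of I) \<P> \<rightarrow>\<^sub>M ereal_gt_minf"
    and cont: "(\<forall>P\<in>\<P>. right_continuous_on I (\<lambda>y. S P y)) \<or>
               (\<forall>P\<in>\<P>. left_continuous_on I (\<lambda>y. S P y))"
  shows "(\<lambda>(P, y). S P y) \<in> eval_algebra (borel_of I) \<P> \<Otimes>\<^sub>M borel_of I \<rightarrow>\<^sub>M ereal_gt_minf"
proof (cases "I = {}")
  case True
  then show ?thesis by (simp add: measurable_def space_pair_measure space_restrict_space)
next
  case False
  obtain s :: real where s: "s \<in> {1, -1}" and S: "\<And>P y. P \<in> \<P> \<Longrightarrow> y \<in> I \<Longrightarrow>
      (S P \<longlongrightarrow> S P y) (at y within (I \<inter> {z. s * y < s * z}))"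
  proof (rule disjE[OF cont])
    assume "\<forall>P\<in>\<P>. right_continuous_on I (\<lambda>y. S P y)"
    then show ?thesis
      by (intro that[of 1]) (auto simp: right_continuous_on_def greaterThan_def)
  next
    assume "\<forall>P\<in>\<P>. left_continuous_on I (\<lambda>y. S P y)"
    then show ?thesis
      by (intro that[of "-1"]) (auto simp: left_continuous_on_def lessThan_def)
  qed
  obtain C d where C: "countable C" "C \<subseteq> I" and d: "\<And>n. d n \<in> borel_of I \<rightarrow>\<^sub>M count_space C"
    and d_lim: "\<And>y. y \<in> I \<Longrightarrow> (\<forall>\<^sub>F n in sequentially. d n y = y) \<or>
      ((\<lambda>n. d n y) \<longlonglongrightarrow> y \<and> (\<forall>\<^sub>F n in sequentially. s * y < s * d n y))"
    using directed_step_approximation[OF interval False s] by metis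
  have d_I: "d n y \<in> I" if "y \<in> I" for n y
    using measurable_space[OF d, of y n] that C(2) by (auto simp: space_restrict_space)
  have lim: "(\<lambda>n. S P (d n y)) \<longlonglongrightarrow> S P y" if P: "P \<in> \<P>" and y: "y \<in> I" for P y
  proof (rule disjE[OF d_lim[OF y]])
    assume "\<forall>\<^sub>F n in sequentially. d n y = y"
    then have "\<forall>\<^sub>F n in sequentially. S P (d n y) = S P y" by eventually_elim simp
    then show ?thesis by (rule tendsto_eventually)
  next
    assume *: "(\<lambda>n. d n y) \<longlonglongrightarrow> y \<and> (\<forall>\<^sub>F n in sequentially. s * y < s * d n y)"
    from conjunct2[OF *]
    have "\<forall>\<^sub>F n in sequentially. d n y \<in> I \<inter> {z. s * y < s * z} \<and> d n y \<noteq> y"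
      by eventually_elim (use d_I[OF y] in auto)
    with * have "filterlim (\<lambda>n. d n y) (at y within (I \<inter> {z. s * y < s * z})) sequentially"
      by (simp add: filterlim_at)
    then show ?thesis by (rule filterlim_compose[OF S[OF P y]])
  qed
  have "(\<lambda>(P, y). S P y) \<in> borel_measurable (eval_algebra (borel_of I) \<P> \<Otimes>\<^sub>M borel_of I)"
  proof (rule borel_measurable_split_step_limit[OF C(1) d])
    show "(\<lambda>P. S P c) \<in> borel_measurable (eval_algebra (borel_of I) \<P>)" if "c \<in> C" for c
      using meas[of c] that C(2) by (auto simp: measurable_restrict_space2_iff)
  qed (use lim in \<open>auto simp: space_restrict_space\<close>)
  then show ?thesis
    using range by (intro measurable_restrict_space2)
      (auto simp: space_pair_measure space_restrict_space)
qed

end
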